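(* Let $x\in\mathbb{R}$, $k\in\mathbb{Z}_{\ge0}$ and $n\in\mathbb{Z}_{>0}$ with $k\le x<k+\frac1n$. Then the $q$-deformation $[x]_q$ is a formal power series of the form $$[x]_q=[k]_q+q^{k+n}+\sum_{i\ge k+n+1}\kappa_i q^i$$ with integer coefficients $\kappa_i$, where $[k]_q=1+q+\cdots+q^{k-1}$ (and $[0]_q=0$).
   Context: For $a\in\mathbb{Z}$ put $[a]_q=\frac{1-q^a}{1-q}$ and $[a]_{q^{-1}}=\frac{1-q^{-a}}{1-q^{-1}}=q^{1-a}[a]_q$. For $x\in\mathbb{R}$ with regular continued fraction expansion $x=[a_1,a_2,a_3,\dots]=a_1+\cfrac{1}{a_2+\cfrac{1}{a_3+\cdots}}$ ($a_1\in\mathbb{Z}$, $a_i\ge1$ for $i\ge2$; finite iff $x$ is rational), the $q$-deformation of $x$ is $$[x]_q=[a_1]_q+\cfrac{q^{a_1}}{[a_2]_{q^{-1}}+\cfrac{q^{-a_2}}{[a_3]_q+\cfrac{q^{a_3}}{[a_4]_{q^{-1}}+\cfrac{q^{-a_4}}{\ddots}}}}.$$ For rational $x$ this is a rational function of $q$ (independent of the choice of the finite expansion), regarded as a Laurent series in $q$; for irrational $x$ the coefficients of the finite truncations stabilize and $[x]_q$ is their limit as a formal Laurent series.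
   Formalization: As stated the claim fails (x = k, or x = 1/3 with k = 0, n = 1, where [x]_q = q^2 − q^3 + …); the formal theorem keeps all hypotheses but includes the term q^{k+n} only when x ≥ k + 1/(n+1), and otherwise its coefficient is 0. *)

theory Defs
  imports Complex_Main "HOL-Computational_Algebra.Formal_Laurent_Series"
begin

section \<open>Regular continued fractions\<close>

text \<open>
  \<^term>\<open>cf_trunc n x\<close> lists the first \<open>n + 1\<close> partial quotients
  of the regular continued fraction of \<open>x\<close>, or all of them if there are fewer.
\<close>

fun cf_trunc :: "nat \<Rightarrow> real \<Rightarrow> int list" where
  "cf_trunc 0 x = [\<lfloor>x\<rfloor>]"
| "cf_trunc (Suc n) x = \<lfloor>x\<rfloor> # (if x \<in> \<int> then [] else cf_trunc n (1 / frac x))"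

fun cf_value :: "int list \<Rightarrow> real" where
  "cf_value [] = 0"
| "cf_value [a] = of_int a"
| "cf_value (a # b # bs) = of_int a + 1 / cf_value (b # bs)"


section \<open>The \<open>q\<close>-deformation\<close>

definition q_int :: "'a::field \<Rightarrow> int \<Rightarrow> 'a" where
  "q_int q a = (1 - q powi a) / (1 - q)"

text \<open>
  The deformed continued fraction alternates between \<open>q\<close> and its inverse; since
  \<open>inverse (inverse q) = q\<close>, this is obtained by inverting the parameter at each level.
\<close>

fun q_cf :: "'a::field \<Rightarrow> int list \<Rightarrow> 'a" where
  "q_cf q [] = 0"
| "q_cf q [a] = q_int q a"
| "q_cf q (a # b # bs) = q_int q a + q powi a / q_cf (inverse q) (b # bs)"

text \<open>
  The limit is taken in the \<open>X\<close>-adic metric of formal Laurent series, that is, coefficients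
  stabilize. For rational \<open>x\<close> the sequence is eventually constant, and evaluating the
  finite continued fraction in the field of Laurent series amounts to expanding the rational
  function at \<open>q = 0\<close>.
\<close>

definition q_real :: "real \<Rightarrow> rat fls" where
  "q_real x = lim (\<lambda>n. q_cf fls_X (cf_trunc n x))"


section \<open>Adequacy of the definitions\<close>

lemma cf_trunc_not_Nil [simp]: "cf_trunc n x \<noteq> []"
  by (cases n) auto

lemma cf_value_Cons: "bs \<noteq> [] \<Longrightarrow> cf_value (a # bs) = of_int a + 1 / cf_value bs"
  by (cases bs) auto

lemma inverse_frac_gt_1: "x \<notin> \<int> \<Longrightarrow> 1 < 1 / frac (x::real)"
  using frac_lt_1[of x] frac_gt_0_iff[of x] by (simp add: field_simps)

lemma cf_trunc_pos:
  assumes "1 \<le> x" "a \<in> set (cf_trunc n x)"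
  shows "1 \<le> a"
  using assms
proof (induction n arbitrary: x)
  case 0
  then show ?case by (simp add: le_floor_iff)
next
  case (Suc n)
  show ?case
  proof (cases "a = \<lfloor>x\<rfloor>")
    case True
    then show ?thesis using Suc.prems by (simp add: le_floor_iff)
  next
    case False
    then have "x \<notin> \<int>" "a \<in> set (cf_trunc n (1 / frac x))"
      using Suc.prems by (auto split: if_splits)
    then show ?thesis using Suc.IH[of "1 / frac x"] inverse_frac_gt_1[of x] by simp
  qed
qed

lemma cf_trunc_tl_pos: "a \<in> set (tl (cf_trunc n x)) \<Longrightarrow> 1 \<le> a"
proof (cases n)
  case (Suc m)
  assume "a \<in> set (tl (cf_trunc n x))"
  with Suc have "x \<notin> \<int>" "a \<in> set (cf_trunc m (1 / frac x))"
    by (auto split: if_splits)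
  then show ?thesis using cf_trunc_pos[of "1 / frac x" a m] inverse_frac_gt_1[of x] by simp
qed simp

lemma cf_value_Suc:
  "x \<notin> \<int> \<Longrightarrow> cf_value (cf_trunc (Suc n) x) = of_int \<lfloor>x\<rfloor> + 1 / cf_value (cf_trunc n (1 / frac x))"
  by (simp add: cf_value_Cons)

lemma cf_value_ge_1: "1 \<le> x \<Longrightarrow> 1 \<le> cf_value (cf_trunc n x)"
proof (induction n arbitrary: x)
  case 0
  then show ?case by (simp add: le_floor_iff)
next
  case (Suc n)
  have f: "1 \<le> real_of_int \<lfloor>x\<rfloor>" using Suc.prems by (simp add: le_floor_iff)
  show ?case
  proof (cases "x \<in> \<int>")
    case True
    then show ?thesis using f by simp
  next
    case False
    have "1 \<le> cf_value (cf_trunc n (1 / frac x))"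
      using Suc.IH inverse_frac_gt_1[OF False] by simp
    then have "0 \<le> 1 / cf_value (cf_trunc n (1 / frac x))" by simp
    then show ?thesis using f cf_value_Suc[OF False, of n] by linarith
  qed
qed

lemma cf_value_error: "\<bar>cf_value (cf_trunc n x) - x\<bar> \<le> 2 * (1/2) ^ n"
proof (induction n arbitrary: x rule: less_induct)
  case (less n)
  have step: "cf_value (cf_trunc (Suc m) z) - z = (w - v) / (v * w)"
    if "z \<notin> \<int>" "w = 1 / frac z" "v = cf_value (cf_trunc m w)" for m z w v
  proof -
    have w: "1 < w" using inverse_frac_gt_1 that by simp
    then have v: "1 \<le> v" using cf_value_ge_1 that by simp
    have "z = of_int \<lfloor>z\<rfloor> + 1 / w" using that by (simp add: frac_def)
    moreover have "cf_value (cf_trunc (Suc m) z) = of_int \<lfloor>z\<rfloor> + 1 / v"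
      using cf_value_Suc that by simp
    ultimately have "cf_value (cf_trunc (Suc m) z) - z = 1 / v - 1 / w" by linarith
    then show ?thesis using v w by (simp add: field_simps)
  qed
  have int: ?case if "x \<in> \<int>"
    using that by (cases n) (auto elim!: Ints_cases)
  consider "n = 0" | "x \<in> \<int>" | "n = 1" "x \<notin> \<int>" | m where "n = Suc (Suc m)" "x \<notin> \<int>"
    by (metis One_nat_def not0_implies_Suc)
  then show ?case
  proof cases
    case 1
    have "\<bar>real_of_int \<lfloor>x\<rfloor> - x\<bar> \<le> 2" by linarith
    with 1 show ?thesis by simp
  next
    case 2
    then show ?thesis by (rule int)
  next
    case 3
    define w where "w = 1 / frac x"
    define v where "v = cf_value (cf_trunc 0 w)"
    have w: "1 < w" using inverse_frac_gt_1 3 w_def by simp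
    have v: "1 \<le> v" using cf_value_ge_1 w v_def less_imp_le by blast
    have vw: "1 \<le> v * w" using v w mult_mono[of 1 v 1 w] by simp
    have "\<bar>w - v\<bar> \<le> 1" unfolding v_def by simp linarith
    then have "\<bar>w - v\<bar> / (v * w) \<le> 1" using vw by (simp add: field_simps)
    then show ?thesis
      using step[OF 3(2) w_def v_def] 3(1) v w by (simp add: abs_mult abs_divide)
  next
    case 4
    define w where "w = 1 / frac x"
    define v where "v = cf_value (cf_trunc (Suc m) w)"
    have w: "1 < w" using inverse_frac_gt_1 4 w_def by simp
    have v: "1 \<le> v" using cf_value_ge_1 w v_def less_imp_le by blast
    have vw: "1 \<le> v * w" using v w mult_mono[of 1 v 1 w] by simp
    have eq: "\<bar>cf_value (cf_trunc n x) - x\<bar> = \<bar>w - v\<bar> / (v * w)"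
      using step[OF 4(2) w_def v_def] 4(1) v w by (simp add: abs_mult abs_divide)
    show ?thesis
    proof (cases "w \<in> \<int>")
      case True
      then have "v = w" unfolding v_def by (auto elim!: Ints_cases)
      then show ?thesis using eq by simp
    next
      case False
      define w' where "w' = 1 / frac w"
      define v' where "v' = cf_value (cf_trunc m w')"
      have w': "1 < w'" using inverse_frac_gt_1 False w'_def by simp
      have v': "1 \<le> v'" using cf_value_ge_1 w' v'_def less_imp_le by blast
      have a: "1 \<le> real_of_int \<lfloor>w\<rfloor>" using w by (simp add: le_floor_iff)
      have W: "w = of_int \<lfloor>w\<rfloor> + 1 / w'" using w'_def by (simp add: frac_def)
      have V: "v = of_int \<lfloor>w\<rfloor> + 1 / v'"
        using cf_value_Suc[OF False, of m] unfolding v_def v'_def w'_def by simp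
      have "w * w' = of_int \<lfloor>w\<rfloor> * w' + 1"
        using w' by (subst W) (simp add: field_simps)
      moreover have "1 * 1 \<le> of_int \<lfloor>w\<rfloor> * w'" using a w' by (intro mult_mono) auto
      ultimately have ww: "2 \<le> w * w'" by linarith
      have "v * v' = of_int \<lfloor>w\<rfloor> * v' + 1"
        using v' by (subst V) (simp add: field_simps)
      moreover have "1 * 1 \<le> of_int \<lfloor>w\<rfloor> * v'" using a v' by (intro mult_mono) auto
      ultimately have vv: "2 \<le> v * v'" by linarith
      have four: "4 \<le> (v * v') * (w * w')" using mult_mono[OF vv ww] vv by simp
      have "\<bar>w - v\<bar> = \<bar>w' - v'\<bar> / (v' * w')"
        using step[OF False w'_def v'_def] v' w' unfolding v_def[symmetric]
        by (metis abs_divide abs_minus_commute abs_of_pos less_le_trans mult_pos_pos zero_less_one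
            less_trans)
      then have "\<bar>cf_value (cf_trunc n x) - x\<bar> = \<bar>w' - v'\<bar> / ((v * v') * (w * w'))"
        using eq by (simp add: mult_ac)
      also have "\<dots> \<le> \<bar>w' - v'\<bar> / 4"
        using four by (intro divide_left_mono) auto
      also have "\<dots> \<le> 2 * (1/2) ^ m / 4"
        using less.IH[of m w'] 4(1) unfolding v'_def by (simp add: abs_minus_commute)
      finally show ?thesis using 4(1) by simp
    qed
  qed
qed

lemma cf_value_tendsto: "(\<lambda>n. cf_value (cf_trunc n x)) \<longlonglongrightarrow> x"
proof -
  have "(\<lambda>n. 2 * (1/2) ^ n :: real) \<longlonglongrightarrow> 2 * 0"
    by (intro tendsto_mult tendsto_const LIMSEQ_power_zero) auto
  then have g: "(\<lambda>n. 2 * (1/2) ^ n :: real) \<longlonglongrightarrow> 0" by simp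
  have "(\<lambda>n. \<bar>cf_value (cf_trunc n x) - x\<bar>) \<longlonglongrightarrow> 0"
    by (rule tendsto_sandwich[OF _ _ tendsto_const g])
      (rule always_eventually, rule allI, rule abs_ge_zero cf_value_error)+
  from LIM_zero_cancel[OF tendsto_rabs_zero_cancel[OF this]] show ?thesis .
qed

lemma cf_trunc_rational:
  assumes "x \<in> \<rat>"
  shows "\<exists>N. cf_value (cf_trunc N x) = x \<and> (\<forall>n\<ge>N. cf_trunc n x = cf_trunc N x)"
proof -
  have "\<exists>N. cf_value (cf_trunc N x) = x \<and> (\<forall>n\<ge>N. cf_trunc n x = cf_trunc N x)"
    if "x = of_int p / of_nat d" "0 < d" for x :: real and p :: int and d :: nat
    using that
  proof (induction d arbitrary: x p rule: less_induct)
    case (less d)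
    show ?case
    proof (cases "x \<in> \<int>")
      case True
      then have "cf_trunc n x = [\<lfloor>x\<rfloor>]" for n by (cases n) auto
      then show ?thesis using True by (auto elim!: Ints_cases)
    next
      case False
      define r where "r = p - \<lfloor>x\<rfloor> * int d"
      have fr: "frac x = of_int r / of_nat d"
        using less.prems by (simp add: frac_def r_def field_simps)
      have "0 < frac x" "frac x < 1" using False frac_lt_1 frac_gt_0_iff by auto
      then have r: "0 < r" "r < int d"
        using less.prems(2) unfolding fr by (auto simp: field_simps)
      have y: "1 / frac x = of_int (int d) / of_nat (nat r)" using r fr by simp
      obtain N where N: "cf_value (cf_trunc N (1 / frac x)) = 1 / frac x"
        "\<And>n. n \<ge> N \<Longrightarrow> cf_trunc n (1 / frac x) = cf_trunc N (1 / frac x)"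
        using less.IH[OF _ y] r by (metis zero_less_nat_eq nat_less_iff less_imp_le)
      have "cf_value (cf_trunc (Suc N) x) = x"
        using cf_value_Suc[OF False, of N] N(1) by (simp add: frac_def)
      moreover have "cf_trunc n x = cf_trunc (Suc N) x" if "n \<ge> Suc N" for n
      proof -
        obtain m where m: "n = Suc m" "m \<ge> N" using \<open>n \<ge> Suc N\<close> by (cases n) auto
        show ?thesis unfolding m(1) cf_trunc.simps N(2)[OF m(2)] ..
      qed
      ultimately show ?thesis by blast
    qed
  qed
  moreover obtain p d where "x = of_int p / of_int d" "d > 0"
    using assms by (auto elim!: Rats_cases')
  then have "x = of_int p / of_nat (nat d)" "0 < nat d" by auto
  ultimately show ?thesis by blast
qed

lemma q_real_rational:
  assumes "x \<in> \<rat>"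
  obtains N where "cf_value (cf_trunc N x) = x" "q_real x = q_cf fls_X (cf_trunc N x)"
proof -
  obtain N where N: "cf_value (cf_trunc N x) = x" "\<forall>n\<ge>N. cf_trunc n x = cf_trunc N x"
    using cf_trunc_rational[OF assms] by blast
  have "(\<lambda>n. q_cf fls_X (cf_trunc n x) :: rat fls) \<longlonglongrightarrow> q_cf fls_X (cf_trunc N x)"
    using N(2) by (intro tendsto_eventually) (metis (mono_tags, lifting) eventually_sequentially)
  then have "q_real x = q_cf fls_X (cf_trunc N x)" unfolding q_real_def by (rule limI)
  with N(1) show ?thesis by (rule that)
qed

text \<open>
  By the next two facts the coefficient of \<open>q ^ (k + n)\<close> in the deformation of
  \<open>x \<in> {k..<k + 1 / n}\<close> need not be \<open>1\<close>: it is \<open>0\<close> for \<open>x = k\<close>, and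
  for \<open>k = 0\<close>, \<open>n = 1\<close>, \<open>x = 1 / 3\<close>.
\<close>

lemma q_real_of_int: "q_real (of_int k) = q_int fls_X k"
proof -
  have "cf_trunc n (of_int k) = [k]" for n by (cases n) auto
  then show ?thesis by (simp add: q_real_def)
qed

lemma q_real_one_third: "q_real (1 / 3) = fls_X ^ 2 / (1 + fls_X + fls_X ^ 2)"
proof -
  have fr: "frac (1 / 3 :: real) = 1 / 3" by (simp add: frac_eq)
  have ni: "(1 / 3 :: real) \<notin> \<int>"
    using fr frac_eq_0_iff[of "1 / 3 :: real"] by simp
  have three: "cf_trunc n 3 = [3]" for n by (cases n) auto
  have "cf_trunc (Suc n) (1 / 3) = [0, 3]" for n
    using ni fr three by simp
  then have "\<forall>n\<ge>1. cf_trunc n (1 / 3) = [0, 3]" by (metis One_nat_def Suc_le_D)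
  then have "(\<lambda>n. q_cf fls_X (cf_trunc n (1 / 3)) :: rat fls) \<longlonglongrightarrow> q_cf fls_X [0, 3]"
    by (intro tendsto_eventually) (auto simp: eventually_sequentially intro!: exI[of _ 1])
  then have "q_real (1 / 3) = q_cf fls_X [0, 3]" unfolding q_real_def by (rule limI)
  also have "\<dots> = fls_X ^ 2 / (1 + fls_X + fls_X ^ 2)"
  proof -
    have X: "(fls_X :: rat fls) \<noteq> 0" "(fls_X :: rat fls) \<noteq> 1"
      by (auto simp: fls_eq_iff intro: exI[of _ 1])
    have "q_cf q [0, 3] = q ^ 2 / (1 + q + q ^ 2)" if "q \<noteq> 0" "q \<noteq> 1" for q :: "rat fls"
    proof -
      have "inverse q \<noteq> 1" using that by (metis inverse_1 inverse_inverse_eq)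
      have "1 - inverse q ^ 3 = (1 + inverse q + inverse q ^ 2) * (1 - inverse q)"
        by (simp add: algebra_simps power2_eq_square power3_eq_cube)
      then have "(1 - inverse q ^ 3) / (1 - inverse q) = 1 + inverse q + inverse q ^ 2"
        using \<open>inverse q \<noteq> 1\<close> by simp
      also have "\<dots> = (1 + q + q ^ 2) / q ^ 2"
        using that by (simp add: field_simps power2_eq_square)
      finally have e: "(1 - inverse q ^ 3) / (1 - inverse q) = (1 + q + q ^ 2) / q ^ 2" .
      have "q_cf q [0, 3] = 1 / ((1 - inverse q ^ 3) / (1 - inverse q))"
        by (simp add: q_int_def power_int_def)
      then show ?thesis unfolding e by simp
    qed
    then show ?thesis using X by blast
  qed
  finally show ?thesis .
qed

end

theory Submission
  imports Defs
begin

text \<open>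
  For \<open>x = k + z\<close> with \<open>k = \<lfloor>x\<rfloor>\<close> the deformation splits as
  \<open>[x]\<^sub>q = [k]\<^sub>q + q\<^sup>k [z]\<^sub>q\<close>, and clearing negative powers of \<open>q\<close> gives
  \[ [z]_q = \frac{q^b}{q [b]_q + 1 / [y]_q} \quad\mbox{for}\quad z = \frac{1}{b + 1 / y}. \]
  If \<open>y \<ge> 1\<close> then \<open>[y]\<^sub>q\<close> and the denominator have constant coefficient 1, so that
  everything takes place in the ring of integral power series. Each such step multiplies
  differences by \<open>q\<^sup>b\<close> times a unit, whence the truncations converge. A single step
  exhibits the leading term of \<open>[z]\<^sub>q\<close>: it is \<open>q\<^sup>b\<close>, or \<open>q ^ (b - 1)\<close> if the
  continued fraction stops at \<open>b\<close>. In both cases the exponent is \<open>\<lceil>1 / z\<rceil> - 1\<close>.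
\<close>

section \<open>Integral power series as Laurent series\<close>

lemma fps_X_power_dvd_iff:
  fixes f :: "'a::comm_ring_1 fps"
  shows "fps_X ^ n dvd f \<longleftrightarrow> (\<forall>i<n. f $ i = 0)"
proof
  assume "fps_X ^ n dvd f"
  then show "\<forall>i<n. f $ i = 0"
    by (auto elim!: dvdE simp: fps_X_power_mult_nth)
next
  assume "\<forall>i<n. f $ i = 0"
  then have "f = fps_X ^ n * fps_shift n f"
    by (auto simp: fps_eq_iff fps_X_power_mult_nth)
  then show "fps_X ^ n dvd f" by (rule dvdI)
qed

lemma fps_X_adic_limit:
  fixes f :: "nat \<Rightarrow> 'a::comm_ring_1 fps"
  assumes "\<And>m n. n \<le> m \<Longrightarrow> fps_X ^ n dvd f m - f n"
  shows "\<exists>l. f \<longlonglongrightarrow> l \<and> (\<forall>n. fps_X ^ n dvd l - f n)"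
proof (intro exI conjI allI)
  define l where "l = Abs_fps (\<lambda>i. f (Suc i) $ i)"
  have stable: "f n $ i = l $ i" if "i < n" for n i
    using assms[of "Suc i" n] that unfolding fps_X_power_dvd_iff by (simp add: l_def)
  then show "f \<longlonglongrightarrow> l"
    by (intro tendsto_fpsI) (auto intro: eventually_mono[OF eventually_gt_at_top])
  show "fps_X ^ n dvd l - f n" for n
    by (simp add: fps_X_power_dvd_iff stable)
qed

lemma tendsto_fps_to_fls:
  fixes f :: "'b \<Rightarrow> 'a::ab_group_add fps"
  assumes "(f \<longlongrightarrow> l) F"
  shows "((\<lambda>x. fps_to_fls (f x)) \<longlongrightarrow> fps_to_fls l) F"
proof -
  have "dist (fps_to_fls g) (fps_to_fls h) = dist g h" for g h :: "'a fps"
    by (simp add: dist_fls_def dist_fps_def fls_subdegree_fls_to_fps flip: fps_to_fls_minus)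
  with assms show ?thesis
    by (simp add: tendsto_dist_iff[of _ l] tendsto_dist_iff[of _ "fps_to_fls l"])
qed

text \<open>
  An inverse only if the constant coefficient is 1; unlike \<^const>\<open>inverse\<close>, it needs no
  division in the coefficient ring.
\<close>

definition fps_recip :: "'a::comm_ring_1 fps \<Rightarrow> 'a fps" where
  "fps_recip f = fps_left_inverse f 1"

lemma fps_recip_nth_0 [simp]: "fps_recip f $ 0 = 1"
  by (simp add: fps_recip_def)

lemma fps_recip_mult: "f $ 0 = 1 \<Longrightarrow> fps_recip f * f = 1"
  by (simp add: fps_recip_def fps_left_inverse)

lemma dvd_fps_recip_diff:
  assumes "f $ 0 = 1" "g $ 0 = 1" "d dvd f - g"
  shows "d dvd fps_recip f - fps_recip g"
proof -
  have "fps_recip f - fps_recip g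
      = fps_recip f * (fps_recip g * g) - (fps_recip f * f) * fps_recip g"
    using assms(1,2) by (simp add: fps_recip_mult)
  also have "\<dots> = - (fps_recip f * fps_recip g * (f - g))"
    by (simp add: algebra_simps)
  finally show ?thesis using assms(3) by simp
qed

definition fls_of_int_fps :: "int fps \<Rightarrow> 'a::comm_ring_1 fls" where
  "fls_of_int_fps f = fps_to_fls (Abs_fps (\<lambda>i. of_int (f $ i)))"

lemma fls_of_int_fps_0 [simp]: "fls_of_int_fps 0 = 0"
  and fls_of_int_fps_1 [simp]: "fls_of_int_fps 1 = 1"
  and fls_of_int_fps_X [simp]: "fls_of_int_fps fps_X = fls_X"
  unfolding fls_of_int_fps_def
  by (simp_all add: fps_eq_iff flip: fps_zero_to_fls fps_one_to_fls fps_X_to_fls)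

lemma fls_of_int_fps_add [simp]:
  "fls_of_int_fps (f + g) = fls_of_int_fps f + fls_of_int_fps g"
  unfolding fls_of_int_fps_def
  by (simp add: fps_plus_def flip: fps_to_fls_plus)

lemma fls_of_int_fps_mult [simp]:
  "fls_of_int_fps (f * g) = fls_of_int_fps f * fls_of_int_fps g"
  unfolding fls_of_int_fps_def
  by (simp add: fps_eq_iff fps_mult_nth flip: fls_times_fps_to_fls)

lemma fls_of_int_fps_power [simp]: "fls_of_int_fps (f ^ n) = fls_of_int_fps f ^ n"
  by (induction n) simp_all

lemma fls_of_int_fps_sum [simp]: "fls_of_int_fps (sum f A) = (\<Sum>i\<in>A. fls_of_int_fps (f i))"
  by (induction A rule: infinite_finite_induct) simp_all

lemma fls_of_int_fps_recip:
  assumes "f $ 0 = 1"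
  shows "(fls_of_int_fps (fps_recip f) :: 'a::field fls) = inverse (fls_of_int_fps f)"
proof -
  have "(fls_of_int_fps f * fls_of_int_fps (fps_recip f) :: 'a fls) = 1"
    using fps_recip_mult[OF assms] by (simp add: mult.commute flip: fls_of_int_fps_mult)
  then show ?thesis by (rule inverse_unique[symmetric])
qed

lemma tendsto_fls_of_int_fps:
  assumes "(f \<longlongrightarrow> l) F"
  shows "((\<lambda>x. fls_of_int_fps (f x)) \<longlongrightarrow> fls_of_int_fps l) F"
  unfolding fls_of_int_fps_def
proof (intro tendsto_fps_to_fls tendsto_fpsI)
  fix n
  have "\<forall>\<^sub>F x in F. f x $ n = l $ n" using assms by (simp add: tendsto_fps_iff)
  then show "\<forall>\<^sub>F x in F.
      Abs_fps (\<lambda>i. of_int (f x $ i)) $ n = Abs_fps (\<lambda>i. of_int (l $ i)) $ n"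
    by eventually_elim simp
qed

section \<open>Deformed continued fractions as power series\<close>

definition fps_q_nat :: "nat \<Rightarrow> 'a::comm_ring_1 fps" where
  "fps_q_nat n = (\<Sum>i<n. fps_X ^ i)"

lemma fps_q_nat_nth: "fps_q_nat n $ i = (if i < n then 1 else 0)"
  by (simp add: fps_q_nat_def fps_sum_nth)

lemma q_int_of_nat: "q \<noteq> 1 \<Longrightarrow> q_int q (int n) = (\<Sum>i<n. q ^ i)"
  by (simp add: q_int_def sum_gp_strict)

lemma q_int_inverse:
  assumes "q \<noteq> 0" "q \<noteq> 1"
  shows "q_int (inverse q) (int n) = q * q_int q (int n) / q ^ n"
proof -
  have "1 - q \<noteq> 0" "q - 1 \<noteq> 0" using assms by auto
  with assms show ?thesis
    by (simp add: q_int_def field_simps)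
qed

text \<open>
  Since \<^term>\<open>q_cf q []\<close> and its inverse are 0, an empty tail needs no separate treatment.
\<close>

lemma q_cf_Cons: "q_cf q (a # as) = q_int q a + q powi a / q_cf (inverse q) as"
  by (cases as) simp_all

lemma q_cf_Cons_Cons:
  assumes "q \<noteq> 0" "q \<noteq> 1"
  shows "q_cf q (int a # int b # as)
    = q_int q (int a) + q ^ a * (q ^ b / (q * q_int q (int b) + inverse (q_cf q as)))"
proof -
  have "q_cf (inverse q) (int b # as)
      = (q * q_int q (int b) + inverse (q_cf q as)) / q ^ b"
    by (simp add: q_cf_Cons q_int_inverse[OF assms] power_inverse add_divide_distrib divide_inverse
        distrib_left mult.commute)
  then show ?thesis by (simp add: q_cf_Cons)
qed

lemma fls_X_neq_0_1: "(fls_X :: 'a::field fls) \<noteq> 0" "(fls_X :: 'a::field fls) \<noteq> 1"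
  by (auto simp: fls_eq_iff intro: exI[of _ 1])

lemma q_int_fls_X: "q_int fls_X (int n) = fls_of_int_fps (fps_q_nat n)"
  by (simp add: fls_X_neq_0_1 q_int_of_nat fps_q_nat_def)

text \<open>The deformation of \<open>z \<mapsto> a + z\<close>.\<close>

definition fps_q_shift :: "nat \<Rightarrow> 'a::comm_ring_1 fps \<Rightarrow> 'a fps" where
  "fps_q_shift a f = fps_q_nat a + fps_X ^ a * f"

lemma fps_q_shift_nth_0: "0 < a \<Longrightarrow> fps_q_shift a f $ 0 = 1"
  by (simp add: fps_q_shift_def fps_q_nat_nth)

lemma fps_q_shift_diff_dvd:
  assumes "fps_X ^ n dvd f - g"
  shows "fps_X ^ (a + n) dvd fps_q_shift a f - fps_q_shift a g"
proof -
  have "fps_q_shift a f - fps_q_shift a g = fps_X ^ a * (f - g)"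
    by (simp add: fps_q_shift_def algebra_simps)
  with assms show ?thesis by (simp add: power_add mult_dvd_mono)
qed

text \<open>
  The deformation of \<open>1 / (b\<^sub>1 + 1 / (b\<^sub>2 + \<dots>))\<close>. The second equation is the third
  one with \<open>1 / y = 0\<close>, where a factor \<open>q\<close> cancels and leaves an invertible denominator.
\<close>

fun fps_cf_frac :: "nat list \<Rightarrow> 'a::comm_ring_1 fps" where
  "fps_cf_frac [] = 0"
| "fps_cf_frac [b] = fps_X ^ (b - 1) * fps_recip (fps_q_nat b)"
| "fps_cf_frac (b # a # as) = fps_X ^ b
    * fps_recip (fps_X * fps_q_nat b + fps_recip (fps_q_shift a (fps_cf_frac as)))"

lemma q_cf_fls_X:
  assumes "\<forall>b\<in>set bs. 0 < b"
  shows "(q_cf fls_X (int a # map int bs) :: 'a::field fls)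
    = fls_of_int_fps (fps_q_shift a (fps_cf_frac bs))"
  using assms
proof (induction bs arbitrary: a rule: fps_cf_frac.induct)
  case 1
  then show ?case by (simp add: fps_q_shift_def q_int_fls_X)
next
  case (2 b)
  then have "fls_X ^ b / (fls_X * fls_of_int_fps (fps_q_nat b))
      = (fls_X ^ (b - 1) * fls_of_int_fps (fps_recip (fps_q_nat b)) :: 'a fls)"
    using fls_X_neq_0_1(1)[where 'a = 'a]
    by (cases b) (simp_all add: fls_of_int_fps_recip fps_q_nat_nth divide_inverse)
  then show ?case
    using q_cf_Cons_Cons[OF fls_X_neq_0_1[where 'a = 'a], of a b "[]"]
    by (simp add: fps_q_shift_def q_int_fls_X del: times_divide_eq_right)
next
  case (3 b c bs)
  then have "(q_cf fls_X (int c # map int bs) :: 'a fls)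
      = fls_of_int_fps (fps_q_shift c (fps_cf_frac bs))"
    by simp
  moreover have "fps_q_shift c (fps_cf_frac bs :: int fps) $ 0 = 1"
    using "3.prems" by (simp add: fps_q_shift_nth_0)
  ultimately show ?case
    using q_cf_Cons_Cons[OF fls_X_neq_0_1[where 'a = 'a], of a b "int c # map int bs"]
    by (simp add: fps_q_shift_def[of a] q_int_fls_X fls_of_int_fps_recip divide_inverse
        del: q_cf.simps)
qed

lemma fps_cf_frac_leading_term:
  fixes b :: nat and bs :: "nat list"
  defines "e \<equiv> (if bs = [] then b - 1 else b)"
  shows "fps_X ^ Suc e dvd fps_cf_frac (b # bs) - (fps_X ^ e :: 'a::comm_ring_1 fps)"
proof -
  obtain u :: "'a fps" where u: "fps_cf_frac (b # bs) = fps_X ^ e * fps_recip u"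
    unfolding e_def by (cases bs) auto
  have "fps_X ^ 1 dvd fps_recip u - 1"
    unfolding fps_X_power_dvd_iff by simp
  then have "fps_X ^ e * fps_X ^ 1 dvd fps_X ^ e * (fps_recip u - 1)"
    by (rule mult_dvd_mono[OF dvd_refl])
  then show ?thesis by (simp add: u right_diff_distrib flip: power_Suc2)
qed

lemma fps_cf_frac_append_dvd:
  assumes "\<forall>a\<in>set as. 0 < a"
  shows "fps_X ^ (sum_list as - 1) dvd
    fps_cf_frac (as @ bs) - (fps_cf_frac as :: 'a::comm_ring_1 fps)"
  using assms
proof (induction as rule: fps_cf_frac.induct)
  case 1
  show ?case by simp
next
  case (2 b)
  have "fps_X ^ (b - 1) dvd (fps_cf_frac (b # bs) :: 'a fps)"
    by (cases bs) (auto intro!: dvd_mult2 le_imp_power_dvd)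
  then show ?case by (simp add: dvd_diff)
next
  case (3 b a as)
  let ?n = "a + (sum_list as - 1)"
  let ?f = "\<lambda>cs. fps_q_shift a (fps_cf_frac cs) :: 'a fps"
  let ?g = "\<lambda>cs. fps_X * fps_q_nat b + fps_recip (?f cs)"
  have "fps_X ^ ?n dvd ?f (as @ bs) - ?f as"
    using 3 by (intro fps_q_shift_diff_dvd) simp_all
  then have "fps_X ^ ?n dvd ?g (as @ bs) - ?g as"
    using "3.prems" by (simp add: dvd_fps_recip_diff fps_q_shift_nth_0)
  then have "fps_X ^ ?n dvd fps_recip (?g (as @ bs)) - fps_recip (?g as)"
    by (intro dvd_fps_recip_diff) simp_all
  then have "fps_X ^ (b + ?n) dvd
      fps_cf_frac ((b # a # as) @ bs) - (fps_cf_frac (b # a # as) :: 'a fps)"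
    by (simp add: power_add mult_dvd_mono flip: right_diff_distrib)
  then show ?case by (rule power_le_dvd) simp
qed

section \<open>The deformation of a nonnegative real number\<close>

definition cf_frac_trunc :: "nat \<Rightarrow> real \<Rightarrow> nat list" where
  "cf_frac_trunc n x = map nat (tl (cf_trunc n x))"

lemma cf_frac_trunc_pos: "b \<in> set (cf_frac_trunc n x) \<Longrightarrow> 0 < b"
  using cf_trunc_tl_pos[of _ n x] by (fastforce simp: cf_frac_trunc_def)

lemma cf_trunc_eq_Cons: "cf_trunc n x = \<lfloor>x\<rfloor> # map int (cf_frac_trunc n x)"
proof -
  have "map int (cf_frac_trunc n x) = tl (cf_trunc n x)"
    unfolding cf_frac_trunc_def map_map
    by (rule map_idI) (use cf_trunc_tl_pos[of _ n x] in fastforce)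
  moreover have "hd (cf_trunc n x) = \<lfloor>x\<rfloor>" by (cases n) simp_all
  ultimately show ?thesis by (metis cf_trunc_not_Nil list.collapse)
qed

lemma cf_trunc_eq_take: "n \<le> m \<Longrightarrow> cf_trunc n x = take (Suc n) (cf_trunc m x)"
proof (induction n x arbitrary: m rule: cf_trunc.induct)
  case (1 x)
  show ?case by (cases m) simp_all
next
  case (2 n x)
  then show ?case by (cases m) simp_all
qed

lemma length_le_sum_list: "\<forall>a\<in>set as. 0 < a \<Longrightarrow> length as \<le> sum_list as" for as :: "nat list"
  by (induction as) auto

lemma fps_cf_frac_trunc_stable:
  assumes "n \<le> m"
  shows "fps_X ^ (n - 1) dvd
    fps_cf_frac (cf_frac_trunc m x) - (fps_cf_frac (cf_frac_trunc n x) :: 'a::comm_ring_1 fps)"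
proof -
  let ?as = "cf_frac_trunc n x" and ?cs = "cf_frac_trunc m x"
  have as_eq_take: "?as = take n ?cs"
    using cf_trunc_eq_take[OF assms, of x] by (simp add: cf_frac_trunc_def take_map take_tl)
  show ?thesis
  proof (cases "n \<le> length ?cs")
    case True
    then have "n \<le> sum_list ?as"
      using length_le_sum_list[of ?as] cf_frac_trunc_pos[of _ n x] by (simp add: as_eq_take)
    moreover have "?cs = ?as @ drop n ?cs" by (simp add: as_eq_take)
    ultimately show ?thesis
      using fps_cf_frac_append_dvd[of ?as "drop n ?cs", where 'a = 'a] cf_frac_trunc_pos[of _ n x]
      by (metis diff_le_mono power_le_dvd)
  next
    case False
    then show ?thesis by (simp add: as_eq_take)
  qed
qed

lemma q_real_eq_fps:
  assumes "0 \<le> x"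
  obtains f where "q_real x = fls_of_int_fps f"
    "\<And>n. fps_X ^ n dvd f - fps_q_shift (nat \<lfloor>x\<rfloor>) (fps_cf_frac (cf_frac_trunc (Suc n) x))"
proof -
  let ?g = "\<lambda>n. fps_q_shift (nat \<lfloor>x\<rfloor>) (fps_cf_frac (cf_frac_trunc (Suc n) x)) :: int fps"
  have stable: "fps_X ^ n dvd ?g m - ?g n" if "n \<le> m" for m n
    using fps_cf_frac_trunc_stable[of "Suc n" "Suc m" x] that
    by (intro power_le_dvd[OF fps_q_shift_diff_dvd[of n]]) simp_all
  obtain f where f: "?g \<longlonglongrightarrow> f" "\<And>n. fps_X ^ n dvd f - ?g n"
    using fps_X_adic_limit[of ?g, OF stable] by blast
  have "q_cf fls_X (cf_trunc n x)
      = (fls_of_int_fps (fps_q_shift (nat \<lfloor>x\<rfloor>) (fps_cf_frac (cf_frac_trunc n x))) :: rat fls)" for n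
    using q_cf_fls_X[of "cf_frac_trunc n x" "nat \<lfloor>x\<rfloor>", where 'a = rat] assms
    by (simp add: cf_trunc_eq_Cons cf_frac_trunc_pos)
  then have "(\<lambda>n. q_cf fls_X (cf_trunc (Suc n) x)) \<longlonglongrightarrow> (fls_of_int_fps f :: rat fls)"
    using tendsto_fls_of_int_fps[OF f(1)] by (simp del: cf_trunc.simps)
  then have "q_real x = fls_of_int_fps f"
    unfolding q_real_def by (intro limI) (rule LIMSEQ_imp_Suc)
  from that[OF this f(2)] show ?thesis .
qed

definition q_frac_order :: "real \<Rightarrow> nat" where
  "q_frac_order x = nat \<lceil>1 / frac x\<rceil> - 1"

lemma q_frac_order_conv_cf_frac_trunc:
  assumes "x \<notin> \<int>"
  obtains b bs where "cf_frac_trunc (Suc (Suc n)) x = b # bs"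
    "q_frac_order x = (if bs = [] then b - 1 else b)"
proof
  define y where "y = 1 / frac x"
  define bs where "bs = tl (cf_frac_trunc (Suc (Suc n)) x)"
  show "cf_frac_trunc (Suc (Suc n)) x = nat \<lfloor>y\<rfloor> # bs"
    using assms by (simp add: cf_frac_trunc_def bs_def y_def)
  have bs: "bs = [] \<longleftrightarrow> y \<in> \<int>"
    using assms cf_trunc_not_Nil by (simp add: cf_frac_trunc_def bs_def y_def)
  show "q_frac_order x = (if bs = [] then nat \<lfloor>y\<rfloor> - 1 else nat \<lfloor>y\<rfloor>)"
  proof (cases "y \<in> \<int>")
    case True
    then show ?thesis by (simp add: bs q_frac_order_def ceiling_altdef flip: y_def)
  next
    case False
    then have "\<lceil>y\<rceil> = \<lfloor>y\<rfloor> + 1" by (metis Ints_of_int ceiling_altdef)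
    moreover have "1 < y" using inverse_frac_gt_1[OF assms] by (simp add: y_def)
    ultimately show ?thesis
      using False by (simp add: bs q_frac_order_def nat_add_distrib flip: y_def)
  qed
qed

lemma q_real_leading_term:
  fixes x :: real
  defines "k \<equiv> nat \<lfloor>x\<rfloor>" and "e \<equiv> q_frac_order x"
  assumes "0 \<le> x" "x \<notin> \<int>"
  obtains f where "q_real x = fls_of_int_fps f"
    "fps_X ^ Suc (k + e) dvd f - (fps_q_nat k + fps_X ^ (k + e))"
proof -
  obtain b bs where bs: "cf_frac_trunc (Suc (Suc (k + e))) x = b # bs"
    "e = (if bs = [] then b - 1 else b)"
    using q_frac_order_conv_cf_frac_trunc[OF assms(4)] unfolding e_def .
  obtain f where f: "q_real x = fls_of_int_fps f"
    "fps_X ^ Suc (k + e) dvd f - fps_q_shift k (fps_cf_frac (b # bs))"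
    using q_real_eq_fps[OF assms(3)] bs(1) unfolding k_def by metis
  have shift: "fps_q_shift k (fps_X ^ e) = (fps_q_nat k + fps_X ^ (k + e) :: int fps)"
    by (simp add: fps_q_shift_def power_add)
  have "fps_X ^ Suc e dvd fps_cf_frac (b # bs) - (fps_X ^ e :: int fps)"
    using bs(2) by (simp only: fps_cf_frac_leading_term)
  from fps_q_shift_diff_dvd[OF this, of k]
  have "fps_X ^ Suc (k + e) dvd
      fps_q_shift k (fps_cf_frac (b # bs)) - (fps_q_nat k + fps_X ^ (k + e) :: int fps)"
    by (simp only: shift add_Suc_right)
  from dvd_add[OF f(2) this] have "fps_X ^ Suc (k + e) dvd f - (fps_q_nat k + fps_X ^ (k + e))"
    by (simp only: add_diff_eq diff_add_cancel)
  with f(1) show ?thesis by (rule that)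
qed

lemma floor_eq_of_nat_interval:
  fixes x :: real and k n :: nat
  assumes "real k \<le> x" "x < real k + 1 / real n"
  shows "\<lfloor>x\<rfloor> = int k"
proof -
  have "1 / real n \<le> 1" by (cases n) simp_all
  with assms show ?thesis by (simp add: floor_eq_iff)
qed

lemma q_frac_order_interval:
  fixes x :: real and k n :: nat
  assumes "0 < n" "real k \<le> x" "x < real k + 1 / real n" "x \<notin> \<int>"
  shows "n \<le> q_frac_order x"
    and "real k + 1 / (real n + 1) \<le> x \<longleftrightarrow> q_frac_order x = n"
proof -
  define y where "y = 1 / frac x"
  have order: "q_frac_order x = nat \<lceil>y\<rceil> - 1" by (simp add: q_frac_order_def y_def)
  have "1 < y" using inverse_frac_gt_1[OF assms(4)] by (simp add: y_def)
  have x: "x = real k + 1 / y"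
    using floor_eq_of_nat_interval[OF assms(2,3)] by (simp add: y_def frac_def)
  have "real n < y" using assms(1,3) \<open>1 < y\<close> by (simp add: x field_simps)
  then show "n \<le> q_frac_order x" unfolding order by linarith
  have "real k + 1 / (real n + 1) \<le> x \<longleftrightarrow> y \<le> real n + 1"
    using \<open>1 < y\<close> by (simp add: x field_simps)
  also have "\<dots> \<longleftrightarrow> q_frac_order x = n"
    using \<open>real n < y\<close> unfolding order by linarith
  finally show "real k + 1 / (real n + 1) \<le> x \<longleftrightarrow> q_frac_order x = n" .
qed

lemma q_real_interval_leading_term:
  fixes x :: real and k n :: nat
  assumes "0 < n" "real k \<le> x" "x < real k + 1 / real n"
  obtains f where "q_real x = fls_of_int_fps f"
    "fps_X ^ Suc (k + n) dvd
      f - (fps_q_nat k + (if real k + 1 / (real n + 1) \<le> x then fps_X ^ (k + n) else 0))"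
proof -
  have floor: "\<lfloor>x\<rfloor> = int k" using floor_eq_of_nat_interval[OF assms(2,3)] .
  show ?thesis
  proof (cases "x \<in> \<int>")
    case True
    then have "x = real k" using floor by (auto elim!: Ints_cases)
    moreover have "\<not> real k + 1 / (real n + 1) \<le> real k" by (simp add: add_pos_nonneg not_le)
    moreover have "q_real (real k) = fls_of_int_fps (fps_q_nat k)"
      using q_real_of_int[of "int k"] by (simp add: q_int_fls_X)
    ultimately show ?thesis by (intro that[of "fps_q_nat k"]) simp_all
  next
    case False
    let ?e = "q_frac_order x"
    have "0 \<le> x" using assms(2) by linarith
    then obtain f where f: "q_real x = fls_of_int_fps f"
      "fps_X ^ Suc (k + ?e) dvd f - (fps_q_nat k + fps_X ^ (k + ?e))"
      using q_real_leading_term[OF _ False] floor by auto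
    have "fps_X ^ Suc (k + n) dvd
        f - (fps_q_nat k + (if ?e = n then fps_X ^ (k + n) else 0))"
      using f(2) q_frac_order_interval(1)[OF assms False] unfolding fps_X_power_dvd_iff by auto
    with f(1) show ?thesis
      by (intro that[of f]) (simp_all add: q_frac_order_interval(2)[OF assms False])
  qed
qed

theorem theorem2p4:
  fixes x :: real and k n :: nat
  assumes "0 < n" and "real k \<le> x" and "x < real k + 1 / real n"
  shows "\<exists>\<kappa> :: nat \<Rightarrow> int. q_real x = fps_to_fls
    ((\<Sum>i<k. fps_X ^ i)
      + (if real k + 1 / (real n + 1) \<le> x then fps_X ^ (k + n) else 0)
      + Abs_fps (\<lambda>i. if k + n + 1 \<le> i then of_int (\<kappa> i) else 0))"
proof -
  let ?in_subinterval = "real k + 1 / (real n + 1) \<le> x"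
  obtain f where f: "q_real x = fls_of_int_fps f"
    "fps_X ^ Suc (k + n) dvd f - (fps_q_nat k + (if ?in_subinterval then fps_X ^ (k + n) else 0))"
    using q_real_interval_leading_term[OF assms] .
  have "f $ i = (if i < k then 1 else 0) + (if ?in_subinterval \<and> i = k + n then 1 else 0)"
    if "i \<le> k + n" for i
    using f(2) that unfolding fps_X_power_dvd_iff by (auto simp: fps_q_nat_nth)
  then have "(Abs_fps (\<lambda>i. of_int (f $ i)) :: rat fps) = (\<Sum>i<k. fps_X ^ i)
      + (if ?in_subinterval then fps_X ^ (k + n) else 0)
      + Abs_fps (\<lambda>i. if k + n + 1 \<le> i then of_int (f $ i) else 0)"
    by (auto simp: fps_eq_iff fps_q_nat_nth simp flip: fps_q_nat_def)
  with f(1) show ?thesis unfolding fls_of_int_fps_def by auto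
qed

end
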